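(* The range $m_{L^1}(\mathcal B)=\{m_{L^1}(A):A\in\mathcal B\}$ of $m_{L^1}$ is not relatively compact in $L^1$.
   Context: $\mu$ is Lebesgue measure on the Borel $\sigma$-algebra $\mathcal B$ of $(-1,1)$, and $L^p=L^p(\mu)$ (complex-valued functions). The finite Hilbert transform of $f\in L^1$ is $T(f)(t):=\lim_{\varepsilon\to0^+}\frac1\pi\left(\int_{-1}^{t-\varepsilon}+\int_{t+\varepsilon}^1\right)\frac{f(x)}{x-t}\,dx$, which exists for a.e. $t\in(-1,1)$ and is measurable. $T$ maps $L^2$ boundedly into $L^2\subseteq L^1$. $m_{L^1}\colon\mathcal B\to L^1$ is the set function $m_{L^1}(A):=T(\chi_A)$, which is $\sigma$-additive (a vector measure). Relative compactness in $L^1$ is with respect to the norm topology. *)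

theory Defs
  imports "HOL-Analysis.Analysis"
begin

definition mu :: "real measure" where
  "mu = restrict_space lborel {-1<..<1}"

definition L1_rel :: "(real \<Rightarrow> complex) \<Rightarrow> (real \<Rightarrow> complex) \<Rightarrow> bool" where
  "L1_rel f g \<longleftrightarrow> integrable mu f \<and> integrable mu g \<and> (AE x in mu. f x = g x)"

lemma L1_rel_part_equivp: "part_equivp L1_rel"
proof (rule part_equivpI)
  show "\<exists>f. L1_rel f f"
    by (rule exI[of _ "\<lambda>_. 0"]) (simp add: L1_rel_def)
  show "symp L1_rel"
    by (auto simp: symp_def L1_rel_def elim: AE_mp)
  show "transp L1_rel"
  proof (rule transpI)
    fix f g h assume "L1_rel f g" "L1_rel g h"
    then show "L1_rel f h"
      unfolding L1_rel_def by (auto elim: AE_mp)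
  qed
qed

quotient_type L1 = "real \<Rightarrow> complex" / partial: L1_rel
  by (rule L1_rel_part_equivp)

instantiation L1 :: real_normed_vector
begin

lift_definition zero_L1 :: L1 is "\<lambda>_. 0"
  by (simp add: L1_rel_def)

lift_definition plus_L1 :: "L1 \<Rightarrow> L1 \<Rightarrow> L1" is "\<lambda>f g x. f x + g x"
  by (auto simp: L1_rel_def)

lift_definition minus_L1 :: "L1 \<Rightarrow> L1 \<Rightarrow> L1" is "\<lambda>f g x. f x - g x"
  by (auto simp: L1_rel_def)

lift_definition uminus_L1 :: "L1 \<Rightarrow> L1" is "\<lambda>f x. - f x"
  by (auto simp: L1_rel_def)

lift_definition scaleR_L1 :: "real \<Rightarrow> L1 \<Rightarrow> L1" is "\<lambda>r f x. r *\<^sub>R f x"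
  by (auto simp: L1_rel_def)

lift_definition norm_L1 :: "L1 \<Rightarrow> real" is "\<lambda>f. LINT x|mu. norm (f x)"
  unfolding L1_rel_def by (intro integral_cong_AE) auto

definition dist_L1 :: "L1 \<Rightarrow> L1 \<Rightarrow> real" where
  "dist_L1 f g = norm (f - g)"

definition sgn_L1 :: "L1 \<Rightarrow> L1" where
  "sgn_L1 f = inverse (norm f) *\<^sub>R f"

definition uniformity_L1 :: "(L1 \<times> L1) filter" where
  "uniformity_L1 = (INF e\<in>{0<..}. principal {(f, g). dist f g < e})"

definition open_L1 :: "L1 set \<Rightarrow> bool" where
  "open_L1 U \<longleftrightarrow> (\<forall>f\<in>U. \<forall>\<^sub>F (f', g) in uniformity. f' = f \<longrightarrow> g \<in> U)"

instance
proof
  fix a b c :: L1 and r s :: real and U :: "L1 set"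
  show "a + b + c = a + (b + c)"
    by transfer (auto simp: L1_rel_def add.assoc)
  show "a + b = b + a"
    by transfer (auto simp: L1_rel_def add.commute)
  show "0 + a = a" by transfer (auto simp: L1_rel_def)
  show "- a + a = 0" by transfer (auto simp: L1_rel_def)
  show "a - b = a + - b" by transfer (auto simp: L1_rel_def)
  show "r *\<^sub>R (a + b) = r *\<^sub>R a + r *\<^sub>R b"
    by transfer (auto simp: L1_rel_def scaleR_add_right)
  show "(r + s) *\<^sub>R a = r *\<^sub>R a + s *\<^sub>R a"
    by transfer (auto simp: L1_rel_def scaleR_add_left)
  show "r *\<^sub>R s *\<^sub>R a = (r * s) *\<^sub>R a"
    by transfer (auto simp: L1_rel_def)
  show "1 *\<^sub>R a = a" by transfer (auto simp: L1_rel_def)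
  show "dist a b = norm (a - b)" by (rule dist_L1_def)
  show "sgn a = inverse (norm a) *\<^sub>R a" by (rule sgn_L1_def)
  show "uniformity = (INF e\<in>{0<..}. principal {(f, g::L1). dist f g < e})"
    by (rule uniformity_L1_def)
  show "open U \<longleftrightarrow> (\<forall>f\<in>U. \<forall>\<^sub>F (f', g) in uniformity. f' = f \<longrightarrow> g \<in> U)"
    by (rule open_L1_def)
  show "norm a = 0 \<longleftrightarrow> a = 0"
    by transfer (auto simp: L1_rel_def integral_nonneg_eq_0_iff_AE)
  show "norm (a + b) \<le> norm a + norm b"
  proof transfer
    fix f g assume "L1_rel f f" "L1_rel g g"
    then have fg: "integrable mu f" "integrable mu g" by (auto simp: L1_rel_def)
    then have "(LINT x|mu. norm (f x + g x)) \<le> (LINT x|mu. norm (f x) + norm (g x))"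
      by (intro integral_mono) (auto intro: norm_triangle_ineq)
    also have "\<dots> = (LINT x|mu. norm (f x)) + (LINT x|mu. norm (g x))"
      using fg by simp
    finally show "(LINT x|mu. norm (f x + g x)) \<le> (LINT x|mu. norm (f x)) + (LINT x|mu. norm (g x))" .
  qed
  show "norm (r *\<^sub>R a) = \<bar>r\<bar> * norm a"
    by transfer simp
qed

end

text \<open>
  Finite Hilbert transform. For integrable \<open>f\<close> the limit exists for almost every
  \<open>t\<close> in \<open>(-1, 1)\<close>; at the remaining points \<^const>\<open>Lim\<close> is an unspecified
  constant, which does not affect the class of \<open>finite_Hilbert f\<close> in \<^typ>\<open>L1\<close>.
\<close>

definition finite_Hilbert :: "(real \<Rightarrow> complex) \<Rightarrow> real \<Rightarrow> complex" where
  "finite_Hilbert f t =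
     Lim (at_right 0) (\<lambda>\<epsilon>. of_real (1 / pi) *
       ((LINT x:{-1<..<t - \<epsilon>}|lborel. f x / of_real (x - t)) +
        (LINT x:{t + \<epsilon><..<1}|lborel. f x / of_real (x - t))))"

text \<open>
  \<^const>\<open>abs_L1\<close> maps an integrable function to its class. It is meaningful here because the
  finite Hilbert transform maps \<open>L\<^sup>2\<close> into \<open>L\<^sup>2 \<subseteq> L\<^sup>1\<close>, so the transform of the indicator
  of a Borel set is integrable.
\<close>

definition m_L1 :: "real set \<Rightarrow> L1" where
  "m_L1 A = abs_L1 (finite_Hilbert (indicator A))"

end

theory Submission
  imports Defs "HOL-Real_Asymp.Real_Asymp"
begin

text \<open>
  The range contains an infinite uniformly separated sequence, so its closure is not sequentially
  compact. For \<open>n = 2 ^ j\<close>, cut \<open>(-1, 1)\<close> at the points \<open>cos (i * pi / (2 * n))\<close>, \<open>i \<le> 2 * n\<close>, and let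
  \<open>comb n\<close> be the union of every other interval. The transform of the indicator of an interval
  \<open>(a, b)\<close> is \<open>(ln \<bar>b - t\<bar> - ln \<bar>a - t\<bar>) / pi\<close>, so the transform of the indicator of \<open>comb n\<close> is
  the logarithm of a quotient of two polynomials. The endpoints are chosen such that these are
  essentially Chebyshev polynomials of the first and second kind: at \<open>t = cos x\<close> the numerator is a
  multiple of \<open>cos (n * x)\<close> and the denominator a multiple of \<open>(1 + t) * sin (n * x) / sin x\<close>
  (\<open>prod_cos_odd\<close>, \<open>prod_cos_even\<close>). Since
  \<open>ln \<bar>cos (n * x) / sin (n * x)\<bar> = artanh (cos (2 * n * x))\<close>, this gives
  \<open>T (indicator (comb n)) = (artanh (cos (2 * n * x)) + h (x)) / pi\<close> with \<open>h\<close> independent of \<open>n\<close>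
  (\<open>comb_transform_eq\<close>).

  The function \<open>artanh\<close> does not decrease distances, so with \<open>D = cos (2 * n * x) - cos (2 * m * x)\<close>
  the difference of two such transforms is at least \<open>\<bar>D\<bar> / pi \<ge> D\<^sup>2 / (2 * pi)\<close>. The integral of
  \<open>D\<^sup>2\<close> with respect to \<open>x\<close> over \<open>(pi / 4, 3 * pi / 4)\<close> equals \<open>pi / 2\<close> for all distinct positive
  even \<open>n\<close> and \<open>m\<close>, by orthogonality of the cosines. There \<open>\<bar>dt / dx\<bar> = sin x \<ge> sqrt 2 / 2\<close>, and
  the distances are bounded from below (\<open>comb_separated\<close>).
\<close>

section \<open>Chebyshev products over dyadic nodes\<close>

lemma prod_pair_reflect:
  fixes f :: "nat \<Rightarrow> real"
  shows "(\<Prod>k<2*n. f k) = (\<Prod>k<n. f k * f (2*n - 1 - k))"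
proof -
  have "{..<2*n} = {..<n} \<union> {n..<2*n}" by auto
  hence "(\<Prod>k<2*n. f k) = (\<Prod>k<n. f k) * (\<Prod>k\<in>{n..<2*n}. f k)"
    by (simp add: prod.union_disjoint ivl_disj_int)
  also have "(\<Prod>k\<in>{n..<2*n}. f k) = (\<Prod>k<n. f (2*n - 1 - k))"
    by (rule prod.reindex_bij_witness[of _ "\<lambda>k. 2*n-1-k" "\<lambda>k. 2*n-1-k"]) auto
  finally show ?thesis by (simp add: prod.distrib)
qed

lemma cos_diff_double:
  "(cos x - cos y) * (cos x - cos (pi - y)) = (cos (2*x) - cos (2*y)) / (2::real)"
  unfolding cos_double_cos cos_pi_minus by (simp add: power2_eq_square algebra_simps)

text \<open>
  The nodes come in pairs symmetric about \<open>pi / 2\<close>; multiplying the two factors of a pair doubles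
  all angles and halves the number of factors.
\<close>

lemma prod_cos_odd_double:
  assumes "n > 0"
  shows "(\<Prod>k<2*n. cos x - cos (real (2*k+1) * pi / real (2*(2*n))))
    = (\<Prod>k<n. cos (2*x) - cos (real (2*k+1) * pi / real (2*n))) / 2 ^ n"
proof -
  have "(cos x - cos (real (2*k+1) * pi / real (2*(2*n))))
     * (cos x - cos (real (2*(2*n-1-k)+1) * pi / real (2*(2*n))))
     = (cos (2*x) - cos (real (2*k+1) * pi / real (2*n))) / 2" if "k < n" for k
  proof -
    have e: "real (2*(2*n-1-k)+1) * pi / real (2*(2*n)) = pi - real (2*k+1) * pi / real (2*(2*n))"
      using that assms by (simp add: of_nat_diff field_simps)
    have e': "2 * (real (2*k+1) * pi / real (2*(2*n))) = real (2*k+1) * pi / real (2*n)"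
      by simp
    show ?thesis unfolding e cos_diff_double e' ..
  qed
  hence "(\<Prod>k<2*n. cos x - cos (real (2*k+1) * pi / real (2*(2*n))))
      = (\<Prod>k<n. (cos (2*x) - cos (real (2*k+1) * pi / real (2*n))) / 2)"
    unfolding prod_pair_reflect by (intro prod.cong) auto
  thus ?thesis by (simp add: prod_dividef)
qed

lemma prod_cos_odd:
  assumes "n = 2 ^ j"
  shows "(\<Prod>k<n. cos x - cos (real (2*k+1) * pi / real (2*n))) = 2 * cos (real n * x) / 2 ^ n"
  using assms
proof (induction j arbitrary: n x)
  case 0 thus ?case by simp
next
  case (Suc j)
  define m where "m = (2::nat) ^ j"
  have n: "n = 2 * m" using Suc.prems by (simp add: m_def)
  have "m > 0" by (simp add: m_def)
  have e: "real m * (2 * x) = real (2 * m) * x" by simp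
  have pow: "(2::real) ^ (2 * m) = 2 ^ m * 2 ^ m" by (simp only: mult_2 power_add)
  show ?case unfolding n prod_cos_odd_double[OF \<open>m > 0\<close>] Suc.IH[OF m_def] e pow by simp
qed

text \<open>
  The same doubling argument; here the middle node \<open>pi / 2\<close> is its own mirror image, and its factor
  \<open>cos x\<close> turns \<open>sin x\<close> into \<open>sin (2 * x) / 2\<close>.
\<close>

lemma prod_cos_even:
  assumes "n = 2 ^ j"
  shows "sin x * (\<Prod>k\<in>{1..<n}. cos x - cos (real (2*k) * pi / real (2*n))) = 2 * sin (real n * x) / 2 ^ n"
  using assms
proof (induction j arbitrary: n x)
  case 0 thus ?case by simp
next
  case (Suc j)
  define m where "m = (2::nat) ^ j"
  have n: "n = 2 * m" using Suc.prems by (simp add: m_def)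
  have m: "m > 0" by (simp add: m_def)
  define f where "f k = cos x - cos (real (2*k) * pi / real (2*n))" for k
  have "{1..<n} = {1..<m} \<union> {m} \<union> {m<..<n}" using m n by auto
  also have "prod f \<dots> = prod f ({1..<m} \<union> {m}) * prod f {m<..<n}"
    by (rule prod.union_disjoint) auto
  also have "prod f ({1..<m} \<union> {m}) = prod f {1..<m} * f m"
    by (subst prod.union_disjoint) auto
  also have "(\<Prod>k\<in>{m<..<n}. f k) = (\<Prod>k\<in>{1..<m}. f (n - k))"
    by (rule prod.reindex_bij_witness[of _ "\<lambda>k. n-k" "\<lambda>k. n-k"]) (use n in auto)
  also have "f m = cos x" using m by (simp add: f_def n field_simps)
  finally have "(\<Prod>k\<in>{1..<n}. f k) = cos x * (\<Prod>k\<in>{1..<m}. f k * f (n - k))"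
    by (simp add: prod.distrib)
  also have "(\<Prod>k\<in>{1..<m}. f k * f (n - k))
     = (\<Prod>k\<in>{1..<m}. (cos (2*x) - cos (real (2*k) * pi / real (2*m))) / 2)"
  proof (rule prod.cong[OF refl])
    fix k assume "k \<in> {1..<m}"
    hence e: "real (2*(n-k)) * pi / real (2*n) = pi - real (2*k) * pi / real (2*n)"
      using m n by (simp add: of_nat_diff field_simps)
    show "f k * f (n - k) = (cos (2*x) - cos (real (2*k) * pi / real (2*m))) / 2"
      unfolding f_def e cos_diff_double by (simp add: n field_simps)
  qed
  also have "\<dots> = (\<Prod>k\<in>{1..<m}. cos (2*x) - cos (real (2*k) * pi / real (2*m))) / 2 ^ (m-1)"
    by (simp add: prod_dividef)
  finally have "sin x * (\<Prod>k\<in>{1..<n}. f k) =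
     (sin (2*x) * (\<Prod>k\<in>{1..<m}. cos (2*x) - cos (real (2*k) * pi / real (2*m)))) / (2 * 2 ^ (m-1))"
    by (simp add: sin_double)
  also have "2 * 2 ^ (m-1) = (2::real) ^ m" using m by (simp add: power_eq_if)
  also have "sin (2*x) * (\<Prod>k\<in>{1..<m}. cos (2*x) - cos (real (2*k) * pi / real (2*m))) = 2 * sin (real m * (2*x)) / 2 ^ m"
    by (rule Suc.IH[OF m_def])
  also have "real m * (2 * x) = real n * x" by (simp add: n)
  also have "2 * sin (real n * x) / 2 ^ m / 2 ^ m = 2 * sin (real n * x) / 2 ^ n"
    unfolding n by (simp only: mult_2[of m] power_add divide_divide_eq_left)
  finally show ?case unfolding f_def .
qed

section \<open>Lower bound for differences of inverse hyperbolic tangents\<close>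

lemma abs_artanh_diff_ge:
  fixes x y :: real
  assumes "\<bar>x\<bar> < 1" "\<bar>y\<bar> < 1"
  shows "\<bar>x - y\<bar> \<le> \<bar>artanh x - artanh y\<bar>"
proof -
  have *: "artanh u - u \<le> artanh v - v" if "u \<le> v" "\<bar>u\<bar> < 1" "\<bar>v\<bar> < 1" for u v :: real
  proof (rule DERIV_nonneg_imp_nondecreasing[OF that(1)])
    fix z assume z: "u \<le> z" "z \<le> v"
    hence "\<bar>z\<bar> < 1" using that by auto
    hence z1: "z^2 < 1" by (simp add: abs_square_less_1)
    have "((\<lambda>z. artanh z - z) has_real_derivative 1 / (1 - z^2) - 1) (at z)"
      using \<open>\<bar>z\<bar> < 1\<close> by (auto intro!: derivative_eq_intros)
    thus "\<exists>y. ((\<lambda>z. artanh z - z) has_real_derivative y) (at z) \<and> 0 \<le> y"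
      using z1 by (intro exI[of _ "1 / (1 - z^2) - 1"]) (auto simp: field_simps)
  qed
  show ?thesis
    using *[of x y] *[of y x] assms by (cases "x \<le> y") auto
qed

section \<open>The finite Hilbert transform of a union of intervals\<close>

lemma FTC_cauchy_kernel:
  fixes c d t :: real
  assumes "c \<le> d" "d < t \<or> t < c"
  shows "(LINT x:{c<..<d}|lborel. 1 / complex_of_real (x - t)) = of_real (ln \<bar>d - t\<bar> - ln \<bar>c - t\<bar>)"
proof -
  have "(LBINT x=ereal c..ereal d. 1 / complex_of_real (x - t)) =
      of_real (ln \<bar>d - t\<bar>) - of_real (ln \<bar>c - t\<bar>)"
  proof (rule interval_integral_FTC_finite)
    show "continuous_on {min c d..max c d} (\<lambda>x. 1 / complex_of_real (x - t))"
      using assms by (auto intro!: continuous_intros)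
    fix x assume x: "min c d \<le> x" "x \<le> max c d"
    have "((\<lambda>x. ln \<bar>x - t\<bar>) has_real_derivative 1 / (x - t)) (at x within {min c d..max c d})"
    proof (cases "x < t")
      case True
      have "((\<lambda>x. ln (t - x)) has_real_derivative 1 / (x - t)) (at x)"
        using True by (auto intro!: derivative_eq_intros simp: field_simps)
      hence "((\<lambda>x. ln \<bar>x - t\<bar>) has_real_derivative 1 / (x - t)) (at x)"
        by (rule has_field_derivative_transform_within_open[of _ _ _ "{..<t}"]) (use True in auto)
      thus ?thesis by (rule has_field_derivative_at_within)
    next
      case False
      hence F: "x > t" using x assms by auto
      have "((\<lambda>x. ln (x - t)) has_real_derivative 1 / (x - t)) (at x)"
        using F by (auto intro!: derivative_eq_intros simp: field_simps)
      hence "((\<lambda>x. ln \<bar>x - t\<bar>) has_real_derivative 1 / (x - t)) (at x)"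
        by (rule has_field_derivative_transform_within_open[of _ _ _ "{t<..}"]) (use F in auto)
      thus ?thesis by (rule has_field_derivative_at_within)
    qed
    hence "((\<lambda>x. complex_of_real (ln \<bar>x - t\<bar>)) has_vector_derivative of_real (1 / (x - t)))
       (at x within {min c d..max c d})"
      by (rule has_vector_derivative_of_real)
    thus "((\<lambda>x. complex_of_real (ln \<bar>x - t\<bar>)) has_vector_derivative 1 / of_real (x - t))
       (at x within {min c d..max c d})" by simp
  qed
  thus ?thesis using assms(1) by (simp add: interval_lebesgue_integral_def)
qed

lemma integrable_ln_abs:
  assumes "\<bar>c\<bar> \<le> 1"
  shows "integrable mu (\<lambda>t. ln \<bar>c - t\<bar>)"
proof -
  \<comment> \<open>Adding \<open>ln 2\<close> makes the integrand nonnegative on \<open>(0, 2)\<close>, so that integrability follows from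
     the limits of an antiderivative at the endpoints.\<close>
  have "set_integrable lborel (einterval (ereal 0) (ereal 2)) (\<lambda>y. ln 2 - ln y)"
  proof (rule interval_integral_FTC_nonneg)
    fix x assume "ereal 0 < ereal x" "ereal x < ereal 2"
    thus "((\<lambda>y. y * ln 2 + y - y * ln y) has_real_derivative ln 2 - ln x) (at x)"
      by (auto intro!: derivative_eq_intros)
  next
    have "((\<lambda>y::real. y * ln 2 + y - y * ln y) \<longlongrightarrow> 0) (at_right 0)"
      by real_asymp
    thus "(((\<lambda>y. y * ln 2 + y - y * ln y) \<circ> real_of_ereal) \<longlongrightarrow> 0) (at_right (ereal 0))"
      by (simp add: ereal_tendsto_simps)
    have "((\<lambda>y::real. y * ln 2 + y - y * ln y) \<longlongrightarrow> 2 * ln 2 + 2 - 2 * ln 2) (at_left 2)"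
      by (intro tendsto_intros) auto
    thus "(((\<lambda>y. y * ln 2 + y - y * ln y) \<circ> real_of_ereal) \<longlongrightarrow> 2 * ln 2 + 2 - 2 * ln 2) (at_left (ereal 2))"
      by (simp add: ereal_tendsto_simps)
  qed (auto intro!: continuous_intros AE_I2)
  hence "integrable lborel (\<lambda>y::real. indicator {0<..<2} y *\<^sub>R (ln 2 - ln y))"
    by (simp add: set_integrable_def)
  hence "integrable lborel (\<lambda>y::real. indicator {0<..<2} y * ln 2 - indicator {0<..<2} y *\<^sub>R (ln 2 - ln y))"
    by (intro Bochner_Integration.integrable_diff) (auto intro!: integrable_mult_left integrable_real_indicator)
  also have "(\<lambda>y. indicator {0<..<2} y * ln 2 - indicator {0<..<2} y *\<^sub>R (ln 2 - ln y))
      = (\<lambda>y::real. indicator {0<..<2} y * ln y)"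
    by (auto simp: algebra_simps)
  finally have L: "integrable lborel (\<lambda>y::real. indicator {0<..<2} y * ln y)" .
  have "integrable lborel (\<lambda>y::real. indicator {0<..<2} (-c + 1 * y) * ln (-c + 1 * y)
     + indicator {0<..<2} (c + (-1) * y) * ln (c + (-1) * y))"
    by (intro Bochner_Integration.integrable_add lborel_integrable_real_affine[OF L, of _ "-c"]
        lborel_integrable_real_affine[OF L, of _ c]) auto
  hence "integrable lborel (\<lambda>y. indicator {-1<..<1} y *\<^sub>R ln \<bar>c - y\<bar>)"
    by (rule Bochner_Integration.integrable_bound)
       (use assms in \<open>auto split: split_indicator intro!: AE_I2\<close>)
  thus ?thesis by (simp add: mu_def integrable_restrict_space)
qed

lemma integrable_truncated_kernel:
  assumes "0 < \<epsilon>" "S \<in> sets borel" "\<And>x. x \<in> S \<Longrightarrow> \<epsilon> \<le> \<bar>x - t\<bar>"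
  shows "integrable lborel (\<lambda>x. indicator S x *\<^sub>R
     ((indicator {a<..<b} x :: complex) / of_real (x - t)))"
proof (cases "a \<le> b")
  case True
  have "integrable lborel (\<lambda>x. indicator {a<..<b} x * (1/\<epsilon>))"
    by (intro integrable_mult_left integrable_real_indicator) (use True in auto)
  thus ?thesis
  proof (rule Bochner_Integration.integrable_bound)
    show "(\<lambda>x. indicator S x *\<^sub>R ((indicator {a<..<b} x :: complex) / of_real (x - t)))
       \<in> borel_measurable lborel" using assms(2) by measurable
    have "1 / \<bar>x - t\<bar> \<le> 1 / \<epsilon>" if "x \<in> S" for x
      using assms(1) assms(3)[OF that] by (intro divide_left_mono) auto
    thus "AE x in lborel. norm (indicator S x *\<^sub>R ((indicator {a<..<b} x :: complex) / of_real (x - t)))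
      \<le> norm (indicator {a<..<b} x * (1/\<epsilon>))"
      using assms(1) by (intro AE_I2) (auto split: split_indicator simp: norm_divide simp flip: of_real_diff)
  qed
qed simp

text \<open>
  For an interval, the truncated integrals are constant once the truncation radius is smaller than
  the distance of \<open>t\<close> to the endpoints: if \<open>t\<close> lies inside, the two terms \<open>ln \<epsilon>\<close> cancel.
\<close>

lemma eventually_truncated_integral_interval:
  assumes "-1 \<le> a" "a < b" "b \<le> 1" "t \<noteq> a" "t \<noteq> b"
  shows "\<forall>\<^sub>F \<epsilon> in at_right 0.
      (LINT x:{-1<..<t - \<epsilon>}|lborel. (indicator {a<..<b} x :: complex) / of_real (x - t)) +
      (LINT x:{t + \<epsilon><..<1}|lborel. indicator {a<..<b} x / of_real (x - t))
      = of_real (ln \<bar>b - t\<bar> - ln \<bar>a - t\<bar>)"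
proof -
  have I: "(LINT x:S|lborel. (indicator {a<..<b} x :: complex) / of_real (x - t))
     = (LINT x:S \<inter> {a<..<b}|lborel. 1 / of_real (x - t))" for S
    unfolding set_lebesgue_integral_def
    by (rule Bochner_Integration.integral_cong) (auto split: split_indicator)
  consider "t < a" | "b < t" | "a < t" "t < b" using assms by linarith
  thus ?thesis
  proof cases
    case 1
    show ?thesis unfolding I eventually_at_right_field
    proof (intro exI[of _ "a - t"] conjI allI impI)
      fix \<epsilon> assume e: "0 < \<epsilon>" "\<epsilon> < a - t"
      have "{-1<..<t - \<epsilon>} \<inter> {a<..<b} = {}" "{t + \<epsilon><..<1} \<inter> {a<..<b} = {a<..<b}"
        using e 1 assms by auto
      thus "(LINT x:{-1<..<t - \<epsilon>} \<inter> {a<..<b}|lborel. 1 / of_real (x - t)) +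
          (LINT x:{t + \<epsilon><..<1} \<inter> {a<..<b}|lborel. 1 / of_real (x - t))
          = complex_of_real (ln \<bar>b - t\<bar> - ln \<bar>a - t\<bar>)"
        using FTC_cauchy_kernel[of a b t] 1 assms by (simp add: set_lebesgue_integral_def)
    qed (use 1 in auto)
  next
    case 2
    show ?thesis unfolding I eventually_at_right_field
    proof (intro exI[of _ "t - b"] conjI allI impI)
      fix \<epsilon> assume e: "0 < \<epsilon>" "\<epsilon> < t - b"
      have "{-1<..<t - \<epsilon>} \<inter> {a<..<b} = {a<..<b}" "{t + \<epsilon><..<1} \<inter> {a<..<b} = {}"
        using e 2 assms by auto
      thus "(LINT x:{-1<..<t - \<epsilon>} \<inter> {a<..<b}|lborel. 1 / of_real (x - t)) +
          (LINT x:{t + \<epsilon><..<1} \<inter> {a<..<b}|lborel. 1 / of_real (x - t))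
          = complex_of_real (ln \<bar>b - t\<bar> - ln \<bar>a - t\<bar>)"
        using FTC_cauchy_kernel[of a b t] 2 assms by (simp add: set_lebesgue_integral_def)
    qed (use 2 in auto)
  next
    case 3
    show ?thesis unfolding I eventually_at_right_field
    proof (intro exI[of _ "min (t - a) (b - t)"] conjI allI impI)
      fix \<epsilon> assume e: "0 < \<epsilon>" "\<epsilon> < min (t - a) (b - t)"
      have S: "{-1<..<t - \<epsilon>} \<inter> {a<..<b} = {a<..<t - \<epsilon>}" "{t + \<epsilon><..<1} \<inter> {a<..<b} = {t + \<epsilon><..<b}"
        using e 3 assms by auto
      show "(LINT x:{-1<..<t - \<epsilon>} \<inter> {a<..<b}|lborel. 1 / of_real (x - t)) +
          (LINT x:{t + \<epsilon><..<1} \<inter> {a<..<b}|lborel. 1 / of_real (x - t))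
          = complex_of_real (ln \<bar>b - t\<bar> - ln \<bar>a - t\<bar>)"
        unfolding S using e 3
        by (subst (1 2) FTC_cauchy_kernel) auto
    qed (use 3 in auto)
  qed
qed

lemma finite_Hilbert_intervals:
  assumes "finite I" "disjoint_family_on (\<lambda>k. {a k<..<b k}) I"
    "\<And>k. k \<in> I \<Longrightarrow> -1 \<le> a k \<and> a k < b k \<and> b k \<le> 1"
    "t \<notin> a ` I \<union> b ` I"
  shows "finite_Hilbert (indicator (\<Union>k\<in>I. {a k<..<b k})) t
     = of_real (1 / pi * (\<Sum>k\<in>I. ln \<bar>b k - t\<bar> - ln \<bar>a k - t\<bar>))"
proof -
  let ?A = "\<Union>k\<in>I. {a k<..<b k}"
  have sum: "(LINT x:S|lborel. (indicator ?A x :: complex) / of_real (x - t)) =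
      (\<Sum>k\<in>I. LINT x:S|lborel. (indicator {a k<..<b k} x :: complex) / of_real (x - t))"
    if "0 < \<epsilon>" "S \<in> sets borel" "\<And>x. x \<in> S \<Longrightarrow> \<epsilon> \<le> \<bar>x - t\<bar>" for S \<epsilon>
    unfolding set_lebesgue_integral_def
    by (subst Bochner_Integration.integral_sum [symmetric])
       (use integrable_truncated_kernel[OF that] in
         \<open>auto simp: indicator_UN_disjoint[OF assms(1,2)] sum_divide_distrib scaleR_sum_right\<close>)
  have "\<forall>\<^sub>F \<epsilon> in at_right 0. \<forall>k\<in>I.
      (LINT x:{-1<..<t - \<epsilon>}|lborel. (indicator {a k<..<b k} x :: complex) / of_real (x - t)) +
      (LINT x:{t + \<epsilon><..<1}|lborel. indicator {a k<..<b k} x / of_real (x - t))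
      = of_real (ln \<bar>b k - t\<bar> - ln \<bar>a k - t\<bar>)"
    using assms by (intro eventually_ball_finite ballI eventually_truncated_integral_interval) auto
  moreover have "\<forall>\<^sub>F \<epsilon> in at_right 0. (0::real) < \<epsilon>"
    by (rule eventually_at_right_less)
  ultimately have "\<forall>\<^sub>F \<epsilon> in at_right 0. of_real (1 / pi) *
       ((LINT x:{-1<..<t - \<epsilon>}|lborel. (indicator ?A x :: complex) / of_real (x - t)) +
        (LINT x:{t + \<epsilon><..<1}|lborel. indicator ?A x / of_real (x - t)))
      = of_real (1 / pi * (\<Sum>k\<in>I. ln \<bar>b k - t\<bar> - ln \<bar>a k - t\<bar>))"
  proof eventually_elim
    case (elim \<epsilon>)
    have "(LINT x:{-1<..<t - \<epsilon>}|lborel. (indicator ?A x :: complex) / of_real (x - t)) +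
        (LINT x:{t + \<epsilon><..<1}|lborel. indicator ?A x / of_real (x - t))
      = (\<Sum>k\<in>I. (LINT x:{-1<..<t - \<epsilon>}|lborel. (indicator {a k<..<b k} x :: complex) / of_real (x - t)) +
          (LINT x:{t + \<epsilon><..<1}|lborel. indicator {a k<..<b k} x / of_real (x - t)))"
      using elim(2) by (subst (1 2) sum[of \<epsilon>]) (auto simp: sum.distrib)
    also have "\<dots> = (\<Sum>k\<in>I. of_real (ln \<bar>b k - t\<bar> - ln \<bar>a k - t\<bar>))"
      using elim(1) by (intro sum.cong) auto
    finally show ?case by simp
  qed
  thus ?thesis unfolding finite_Hilbert_def
    by (intro tendsto_Lim tendsto_eventually) auto
qed

section \<open>Orthogonality of the cosines\<close>

text \<open>
  In the variable \<open>\<theta> = arccos x\<close> this is the integral of \<open>(cos (4 * p * \<theta>) - cos (4 * q * \<theta>))\<^sup>2\<close>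
  over \<open>{pi / 4..3 * pi / 4}\<close>. All oscillating terms of the antiderivative vanish at the endpoints,
  because the frequencies are multiples of \<open>4\<close>.
\<close>

lemma has_bochner_integral_sq_diff_cos:
  fixes p q :: nat
  assumes "p > 0" "q > 0" "p \<noteq> q"
  shows "has_bochner_integral lborel (\<lambda>x. indicator {-(sqrt 2 / 2)..sqrt 2 / 2} x *\<^sub>R
     ((cos (4 * real p * arccos x) - cos (4 * real q * arccos x))\<^sup>2 / sqrt (1 - x\<^sup>2))) (pi / 2)"
proof -
  define s where "s = sqrt 2 / (2::real)"
  define P Q where "P = real p" and "Q = real q"
  have PQ: "P > 0" "Q > 0" "P \<noteq> Q" using assms by (auto simp: P_def Q_def)
  have Ints: "P \<in> \<int>" "Q \<in> \<int>" by (auto simp: P_def Q_def)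
  have s: "0 < s" "s < 1" by (auto simp: s_def real_sqrt_less_iff intro: real_less_lsqrt)
  define G where "G \<theta> = \<theta> + sin (8*P*\<theta>) / (8*P) / 2 + sin (8*Q*\<theta>) / (8*Q) / 2
     - sin (4*(P-Q)*\<theta>) / (4*(P-Q)) - sin (4*(P+Q)*\<theta>) / (4*(P+Q))" for \<theta>
  have dsin: "((\<lambda>\<theta>. sin (c * \<theta>) / c) has_real_derivative cos (c * \<theta>)) (at \<theta>)" if "c \<noteq> 0" for c \<theta> :: real
    using that by (auto intro!: derivative_eq_intros)
  have dG: "(G has_real_derivative (cos (4*P*\<theta>) - cos (4*Q*\<theta>))\<^sup>2) (at \<theta>)" for \<theta>
  proof -
    have "(G has_real_derivative 1 + cos (8*P*\<theta>) / 2 + cos (8*Q*\<theta>) / 2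
        - cos (4*(P-Q)*\<theta>) - cos (4*(P+Q)*\<theta>)) (at \<theta>)"
      unfolding G_def using PQ by (intro DERIV_add DERIV_diff DERIV_cdivide DERIV_ident dsin) auto
    also have "1 + cos (8*P*\<theta>) / 2 + cos (8*Q*\<theta>) / 2 - cos (4*(P-Q)*\<theta>) - cos (4*(P+Q)*\<theta>)
        = (cos (4*P*\<theta>) - cos (4*Q*\<theta>))\<^sup>2"
    proof -
      have "cos (8*P*\<theta>) = 2 * (cos (4*P*\<theta>))\<^sup>2 - 1"
        using cos_double_cos[of "4*P*\<theta>"] by (simp add: mult.assoc)
      moreover have "cos (8*Q*\<theta>) = 2 * (cos (4*Q*\<theta>))\<^sup>2 - 1"
        using cos_double_cos[of "4*Q*\<theta>"] by (simp add: mult.assoc)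
      moreover have "cos (4*(P-Q)*\<theta>) + cos (4*(P+Q)*\<theta>) = 2 * cos (4*P*\<theta>) * cos (4*Q*\<theta>)"
        using cos_add[of "4*P*\<theta>" "4*Q*\<theta>"] cos_diff[of "4*P*\<theta>" "4*Q*\<theta>"]
        by (simp add: distrib_left distrib_right left_diff_distrib right_diff_distrib)
      ultimately show ?thesis
        unfolding power2_diff by linarith
    qed
    finally show ?thesis .
  qed
  have Gv: "G (real k * pi / 4) = real k * pi / 4" for k :: nat
  proof -
    have z: "sin (x * pi) = 0" if "x \<in> \<int>" for x :: real
      using that by (simp add: sin_times_pi_eq_0)
    have e: "8*P*(real k * pi / 4) = (2*P*real k) * pi"
      "8*Q*(real k * pi / 4) = (2*Q*real k) * pi"
      "4*(P-Q)*(real k * pi / 4) = ((P-Q)*real k) * pi"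
      "4*(P+Q)*(real k * pi / 4) = ((P+Q)*real k) * pi" by (simp_all add: field_simps)
    have "sin (8*P*(real k * pi / 4)) = 0" "sin (8*Q*(real k * pi / 4)) = 0"
      "sin (4*(P-Q)*(real k * pi / 4)) = 0" "sin (4*(P+Q)*(real k * pi / 4)) = 0"
      unfolding e using Ints by (auto intro!: z)
    thus ?thesis unfolding G_def by (simp only: div_0 add_0_right diff_0_right)
  qed
  have "arccos s = pi / 4" using arccos_cos[of "pi/4"] by (simp add: s_def cos_45)
  moreover have "arccos (-s) = pi - arccos s" using s by (intro arccos_minus) auto
  ultimately have ac: "arccos s = pi / 4" "arccos (-s) = 3 * pi / 4" by simp_all
  have "has_bochner_integral lborel (\<lambda>x. indicator {-s..s} x *\<^sub>R
     ((cos (4 * P * arccos x) - cos (4 * Q * arccos x))\<^sup>2 / sqrt (1 - x\<^sup>2)))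
      (- G (arccos s) - - G (arccos (-s)))"
  proof (rule has_bochner_integral_FTC_Icc)
    fix x assume "-s \<le> x" "x \<le> s"
    hence x: "-1 < x" "x < 1" using s by auto
    have "((\<lambda>x. - G (arccos x)) has_real_derivative
       - ((cos (4*P*arccos x) - cos (4*Q*arccos x))\<^sup>2 * inverse (- sqrt (1 - x\<^sup>2)))) (at x)"
      by (intro DERIV_minus DERIV_chain2[OF dG] DERIV_arccos x)
    also have "- ((cos (4*P*arccos x) - cos (4*Q*arccos x))\<^sup>2 * inverse (- sqrt (1 - x\<^sup>2)))
        = (cos (4*P*arccos x) - cos (4*Q*arccos x))\<^sup>2 / sqrt (1 - x\<^sup>2)"
      by (simp only: inverse_minus_eq divide_inverse mult_minus_right minus_minus)
    finally show "((\<lambda>x. - G (arccos x)) has_vector_derivative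
        (cos (4 * P * arccos x) - cos (4 * Q * arccos x))\<^sup>2 / sqrt (1 - x\<^sup>2)) (at x within {-s..s})"
      unfolding has_real_derivative_iff_has_vector_derivative
      by (rule has_vector_derivative_at_within)
  next
    have "x\<^sup>2 < 1" if "x \<in> {-s..s}" for x
      using that s by (auto simp: abs_square_less_1 abs_less_iff)
    hence nz: "\<forall>x\<in>{-s..s}. sqrt (1 - x\<^sup>2) \<noteq> 0" by force
    have "\<forall>x\<in>{-s..s}. -1 \<le> x \<and> x \<le> 1" using s by auto
    thus "continuous_on {-s..s}
        (\<lambda>x. (cos (4 * P * arccos x) - cos (4 * Q * arccos x))\<^sup>2 / sqrt (1 - x\<^sup>2))"
      by (intro continuous_intros nz)
  qed (use s in auto)
  moreover have "- G (arccos s) - - G (arccos (-s)) = pi / 2"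
    using Gv[of 1] Gv[of 3] unfolding ac by simp
  ultimately show ?thesis unfolding s_def P_def Q_def by (simp only:)
qed

section \<open>Comb sets and their transforms\<close>

text \<open>
  For \<open>n \<ge> 1\<close> the points \<open>node n i\<close> decrease from \<open>1\<close> at \<open>i = 0\<close> to \<open>-1\<close> at \<open>i = 2 * n\<close>. Those with odd \<open>i\<close> are the
  zeros of the Chebyshev polynomial of the first kind of degree \<open>n\<close>; those with even \<open>i\<close>, apart from
  \<open>1\<close> and \<open>-1\<close>, are the zeros of the one of the second kind of degree \<open>n - 1\<close>.
\<close>

definition node :: "nat \<Rightarrow> nat \<Rightarrow> real" where
  "node n i = cos (real i * pi / real (2 * n))"

text \<open>Every other interval of the partition by the nodes, with an even node at its left end.\<close>

definition comb :: "nat \<Rightarrow> real set" where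
  "comb n = (\<Union>k<n. {node n (2*k+2)<..<node n (2*k+1)})"

text \<open>
  The finite Hilbert transform of the indicator of \<open>comb n\<close>, in closed form and as a real function.
  It differs from the transform at most at the nodes.
\<close>

definition comb_transform :: "nat \<Rightarrow> real \<Rightarrow> real" where
  "comb_transform n t = 1 / pi * (\<Sum>k<n. ln \<bar>node n (2*k+1) - t\<bar> - ln \<bar>node n (2*k+2) - t\<bar>)"

lemma node_strict_antimono:
  assumes "i < j" "j \<le> 2 * n"
  shows "node n j < node n i"
  unfolding node_def using assms
  by (intro cos_monotone_0_pi) (auto simp: field_simps divide_strict_right_mono)

lemma node_antimono:
  assumes "i \<le> j" "j \<le> 2 * n"
  shows "node n j \<le> node n i"
  using node_strict_antimono[of i j n] assms by (cases "i = j") auto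

lemma finite_Hilbert_comb:
  assumes "t \<notin> node n ` {..2*n}"
  shows "finite_Hilbert (indicator (comb n)) t = of_real (comb_transform n t)"
  unfolding comb_def comb_transform_def
proof (rule finite_Hilbert_intervals)
  show "disjoint_family_on (\<lambda>k. {node n (2*k+2)<..<node n (2*k+1)}) {..<n}"
  proof -
    have "{node n (2*k+2)<..<node n (2*k+1)} \<inter> {node n (2*l+2)<..<node n (2*l+1)} = {}"
      if "k < l" "l < n" for k l
      using node_antimono[of "2*k+2" "2*l+1" n] that by fastforce
    thus ?thesis unfolding disjoint_family_on_def
      by (metis lessThan_iff linorder_neqE_nat Int_commute)
  qed
next
  fix k assume "k \<in> {..<n}"
  thus "- 1 \<le> node n (2*k+2) \<and> node n (2*k+2) < node n (2*k+1) \<and> node n (2*k+1) \<le> 1"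
    by (intro conjI node_strict_antimono) (auto simp: node_def)
next
  show "t \<notin> (\<lambda>k. node n (2*k+2)) ` {..<n} \<union> (\<lambda>k. node n (2*k+1)) ` {..<n}"
  proof
    assume "t \<in> (\<lambda>k. node n (2*k+2)) ` {..<n} \<union> (\<lambda>k. node n (2*k+1)) ` {..<n}"
    then obtain k where "k < n" "t = node n (2*k+2) \<or> t = node n (2*k+1)" by auto
    thus False using assms by (auto simp: image_iff)
  qed
qed simp

lemma integrable_comb_transform: "integrable mu (comb_transform n)"
  unfolding comb_transform_def
  by (intro integrable_mult_right Bochner_Integration.integrable_sum Bochner_Integration.integrable_diff
      integrable_ln_abs) (auto simp: node_def)

text \<open>
  In particular the transform is Borel measurable and integrable, whatever the values at the
  finitely many nodes where the principal value does not exist.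
\<close>

lemma L1_rel_comb: "L1_rel (finite_Hilbert (indicator (comb n))) (\<lambda>t. of_real (comb_transform n t))"
proof -
  let ?X = "node n ` {..2*n} \<inter> {-1<..<1}"
  have eq: "of_real (comb_transform n t) = finite_Hilbert (indicator (comb n)) t"
    if "t \<in> space mu" "t \<notin> ?X" for t
    using that by (subst finite_Hilbert_comb) (auto simp: mu_def space_restrict_space)
  have int: "integrable mu (\<lambda>t. complex_of_real (comb_transform n t))"
    by (intro integrable_of_real integrable_comb_transform)
  have null: "emeasure mu {x} = 0" "{x} \<in> sets mu" if "x \<in> ?X" for x
    using that by (auto simp: mu_def emeasure_restrict_space sets_restrict_space_iff)
  have "integrable mu (finite_Hilbert (indicator (comb n)))"
    by (subst integrable_discrete_difference[of ?X, symmetric])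
       (use null eq int in \<open>auto intro!: countable_finite\<close>)
  moreover have "AE t in mu. t \<notin> ?X"
    by (rule AE_discrete_difference) (use null in \<open>auto intro!: countable_finite\<close>)
  hence "AE t in mu. finite_Hilbert (indicator (comb n)) t = of_real (comb_transform n t)"
    using AE_space by eventually_elim (use eq in auto)
  ultimately show ?thesis using int by (simp add: L1_rel_def)
qed

text \<open>The second summand does not depend on \<open>n\<close> and cancels in differences.\<close>

lemma comb_transform_eq:
  assumes n: "n = 2 ^ j" and t: "-1 < t" "t < 1" "t \<notin> node n ` {..2*n}"
  shows "\<bar>cos (2 * real n * arccos t)\<bar> < 1"
    and "comb_transform n t = 1 / pi * (artanh (cos (2 * real n * arccos t)) + ln (sqrt (1 - t\<^sup>2) / (1 + t)))"
proof -
  define x where "x = arccos t"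
  have x: "cos x = t" "sin x = sqrt (1 - t\<^sup>2)" using t by (auto simp: x_def sin_arccos)
  have sx: "sin x > 0" using t by (auto simp: x abs_square_less_1)
  have n0: "n > 0" using n by simp
  have nz: "node n i \<noteq> t" if "i \<le> 2*n" for i using t(3) that by auto
  have odd: "(\<Prod>k<n. t - node n (2*k+1)) = 2 * cos (real n * x) / 2 ^ n"
    using prod_cos_odd[OF n, of x] by (simp add: x node_def)
  have "(\<Prod>k<n. t - node n (2*k+2)) = (\<Prod>k\<in>{1..n}. t - node n (2*k))"
    by (rule prod.reindex_bij_witness[of _ "\<lambda>k. k - 1" Suc]) auto
  \<comment> \<open>The even node with index \<open>2 * n\<close> is \<open>-1\<close>; it contributes the factor \<open>t + 1\<close>.\<close>
  also have "{1..n} = insert n {1..<n}" using n0 by auto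
  also have "(\<Prod>k\<in>insert n {1..<n}. t - node n (2*k)) = (t + 1) * (\<Prod>k\<in>{1..<n}. t - node n (2*k))"
    using n0 by (subst prod.insert) (auto simp: node_def)
  finally have "sin x * (\<Prod>k<n. t - node n (2*k+2)) = (t + 1) * (sin x * (\<Prod>k\<in>{1..<n}. t - node n (2*k)))"
    by simp
  also have "\<dots> = (t + 1) * (2 * sin (real n * x) / 2 ^ n)"
    using prod_cos_even[OF n, of x] by (simp add: x node_def)
  finally have even: "(\<Prod>k<n. t - node n (2*k+2)) = (t + 1) / sin x * (2 * sin (real n * x) / 2 ^ n)"
    using sx by (simp add: field_simps)
  have "(\<Prod>k<n. t - node n (2*k+1)) \<noteq> 0" using nz by (auto simp: eq_commute[of t])
  hence c: "cos (real n * x) \<noteq> 0" unfolding odd by auto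
  have "(\<Prod>k<n. t - node n (2*k+2)) \<noteq> 0" using nz by (auto simp: eq_commute[of t])
  hence s: "sin (real n * x) \<noteq> 0" unfolding even by auto
  have c2: "1 + cos (2 * real n * x) = 2 * (cos (real n * x))\<^sup>2"
    using cos_double_cos[of "real n * x"] by (simp add: mult.assoc)
  have s2: "1 - cos (2 * real n * x) = 2 * (sin (real n * x))\<^sup>2"
    using cos_double_sin[of "real n * x"] by (simp add: mult.assoc)
  have "1 + cos (2 * real n * x) > 0" "1 - cos (2 * real n * x) > 0"
    unfolding c2 s2 using c s by auto
  thus "\<bar>cos (2 * real n * arccos t)\<bar> < 1" unfolding x_def by auto
  have "artanh (cos (2 * real n * x)) = ln ((cos (real n * x) / sin (real n * x))\<^sup>2) / 2"
    unfolding artanh_def c2 s2 by (simp add: power_divide)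
  also have "\<dots> = ln (\<bar>cos (real n * x) / sin (real n * x)\<bar>\<^sup>2) / 2"
    by (simp only: power2_abs)
  also have "\<dots> = ln \<bar>cos (real n * x) / sin (real n * x)\<bar>"
    using c s by (subst ln_realpow) auto
  finally have A: "artanh (cos (2 * real n * x)) = ln \<bar>cos (real n * x)\<bar> - ln \<bar>sin (real n * x)\<bar>"
    using c s by (simp add: abs_divide ln_div)
  have lnsum: "(\<Sum>k<n. ln \<bar>node n (f k) - t\<bar>) = ln \<bar>\<Prod>k<n. t - node n (f k)\<bar>"
    if "\<And>k. k < n \<Longrightarrow> f k \<le> 2 * n" for f
    using nz that by (subst abs_prod, subst ln_prod) (auto simp: abs_minus_commute)
  have "(\<Sum>k<n. ln \<bar>node n (2*k+1) - t\<bar> - ln \<bar>node n (2*k+2) - t\<bar>)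
    = ln \<bar>2 * cos (real n * x) / 2 ^ n\<bar> - ln \<bar>(t + 1) / sin x * (2 * sin (real n * x) / 2 ^ n)\<bar>"
    using lnsum[of "\<lambda>k. 2*k+1"] lnsum[of "\<lambda>k. 2*k+2"] unfolding sum_subtractf odd even by simp
  also have "\<dots> = artanh (cos (2 * real n * x)) + ln (sin x / (1 + t))"
    unfolding A using c s sx t by (simp add: abs_mult abs_divide ln_mult ln_div add.commute)
  finally show "comb_transform n t = 1 / pi * (artanh (cos (2 * real n * arccos t)) + ln (sqrt (1 - t\<^sup>2) / (1 + t)))"
    by (simp add: comb_transform_def x x_def[symmetric])
qed

section \<open>Separation and non-compactness\<close>

lemma dist_m_L1_comb:
  "dist (m_L1 (comb n)) (m_L1 (comb m)) = (LINT t|mu. \<bar>comb_transform n t - comb_transform m t\<bar>)"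
proof -
  have eq: "m_L1 (comb k) = abs_L1 (\<lambda>t. of_real (comb_transform k t))" for k
    unfolding m_L1_def using L1_rel_comb
    by (metis Quotient_L1 Quotient_rel_abs)
  have rel: "L1_rel (\<lambda>t. of_real (comb_transform k t)) (\<lambda>t. of_real (comb_transform k t))" for k
    using L1_rel_comb by (simp add: L1_rel_def)
  have "L1_rel (\<lambda>t. complex_of_real (comb_transform n t) - of_real (comb_transform m t))
     (\<lambda>t. complex_of_real (comb_transform n t) - of_real (comb_transform m t))"
    using rel[of n] rel[of m] by (simp add: L1_rel_def)
  thus ?thesis
    by (simp add: dist_L1_def eq minus_L1.abs_eq rel norm_L1.abs_eq flip: of_real_diff)
qed

lemma comb_separated:
  assumes "i \<noteq> j"
  shows "1 / 8 \<le> dist (m_L1 (comb (2 ^ Suc i))) (m_L1 (comb (2 ^ Suc j)))"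
proof -
  define p q n m where "p = (2::nat) ^ i" and "q = (2::nat) ^ j"
    and "n = (2::nat) ^ Suc i" and "m = (2::nat) ^ Suc j"
  have nm: "n = 2 * p" "m = 2 * q" by (auto simp: p_def q_def n_def m_def)
  have pq: "p > 0" "q > 0" "p \<noteq> q" using assms by (auto simp: p_def q_def)
  \<comment> \<open>On \<open>{-s..s}\<close> the factor \<open>1 / sqrt (1 - x\<^sup>2) = \<bar>arccos' x\<bar>\<close> is at most \<open>1 / s\<close>.\<close>
  define s where "s = sqrt 2 / (2::real)"
  have s: "0 < s" "s < 1" by (auto simp: s_def intro: real_less_lsqrt)
  have s2: "s\<^sup>2 = 1/2" by (simp add: s_def power_divide)
  define D where "D x = cos (4 * real p * arccos x) - cos (4 * real q * arccos x)" for x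
  let ?X = "node n ` {..2*n} \<union> node m ` {..2*m}"
  have hb: "has_bochner_integral lborel (\<lambda>x. indicator {-s..s} x *\<^sub>R ((D x)\<^sup>2 / sqrt (1 - x\<^sup>2))) (pi/2)"
    using has_bochner_integral_sq_diff_cos[OF pq] by (simp add: D_def s_def)
  have bound: "s / (2*pi) * (indicator {-s..s} x *\<^sub>R ((D x)\<^sup>2 / sqrt (1 - x\<^sup>2)))
      \<le> indicator {-1<..<1} x *\<^sub>R \<bar>comb_transform n x - comb_transform m x\<bar>"
    if "x \<notin> ?X" for x
  proof (cases "x \<in> {-s..s}")
    case True
    hence x: "-1 < x" "x < 1" "\<bar>x\<bar> \<le> \<bar>s\<bar>" using s by auto
    have "x\<^sup>2 \<le> s\<^sup>2" using x by (simp only: abs_le_square_iff)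
    hence "s\<^sup>2 \<le> 1 - x\<^sup>2" using s2 by simp
    hence r: "s \<le> sqrt (1 - x\<^sup>2)" by (rule real_le_rsqrt)
    have "\<bar>D x\<bar> \<le> 2" unfolding D_def
      using abs_triangle_ineq4[of "cos (4 * real p * arccos x)" "cos (4 * real q * arccos x)"]
        abs_cos_le_one[of "4 * real p * arccos x"] abs_cos_le_one[of "4 * real q * arccos x"]
      by linarith
    hence "(D x)\<^sup>2 \<le> 2 * \<bar>D x\<bar>" using mult_right_mono[of "\<bar>D x\<bar>" 2 "\<bar>D x\<bar>"]
      by (simp add: power2_eq_square)
    moreover have "s * (D x)\<^sup>2 / sqrt (1 - x\<^sup>2) \<le> (D x)\<^sup>2"
    proof -
      have "0 < sqrt (1 - x\<^sup>2)" using r s by linarith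
      thus ?thesis using mult_right_mono[OF r, of "(D x)\<^sup>2"]
        by (simp only: pos_divide_le_eq mult.commute zero_le_power2 simp_thms)
    qed
    ultimately have 1: "s * (D x)\<^sup>2 / sqrt (1 - x\<^sup>2) \<le> 2 * \<bar>D x\<bar>" by linarith
    note en = comb_transform_eq[OF n_def x(1,2)] and em = comb_transform_eq[OF m_def x(1,2)]
    have "\<bar>D x\<bar> \<le> \<bar>artanh (cos (2 * real n * arccos x)) - artanh (cos (2 * real m * arccos x))\<bar>"
      using abs_artanh_diff_ge[OF en(1) em(1)] that unfolding D_def nm by simp
    also have "\<dots> = pi * \<bar>comb_transform n x - comb_transform m x\<bar>"
      using that by (simp add: en(2) em(2) flip: right_diff_distrib diff_divide_distrib)
    finally have "s * (D x)\<^sup>2 / sqrt (1 - x\<^sup>2) \<le> 2 * (pi * \<bar>comb_transform n x - comb_transform m x\<bar>)"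
      using 1 by linarith
    hence "s * (D x)\<^sup>2 / sqrt (1 - x\<^sup>2) / (2*pi) \<le> \<bar>comb_transform n x - comb_transform m x\<bar>"
      by (subst pos_divide_le_eq) (auto simp: mult_ac)
    thus ?thesis using True x by (simp add: mult_ac)
  qed (auto split: split_indicator)
  have "?X \<in> null_sets lborel" by (intro finite_imp_null_set_lborel) auto
  hence "AE x in lborel. x \<notin> ?X" by (rule AE_not_in)
  hence AE: "AE x in lborel. s / (2*pi) * (indicator {-s..s} x *\<^sub>R ((D x)\<^sup>2 / sqrt (1 - x\<^sup>2)))
      \<le> indicator {-1<..<1} x *\<^sub>R \<bar>comb_transform n x - comb_transform m x\<bar>"
    by eventually_elim (rule bound)
  have int: "integrable mu (\<lambda>t. \<bar>comb_transform n t - comb_transform m t\<bar>)"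
    by (intro integrable_abs Bochner_Integration.integrable_diff integrable_comb_transform)
  have "1/8 \<le> s / (2*pi) * (pi/2)"
    by (simp add: s_def)
  also have "\<dots> = (LINT x|lborel. s / (2*pi) * (indicator {-s..s} x *\<^sub>R ((D x)\<^sup>2 / sqrt (1 - x\<^sup>2))))"
    by (rule has_bochner_integral_integral_eq[symmetric], rule has_bochner_integral_mult_right, rule hb)
  also have "\<dots> \<le> (LINT x|lborel. indicator {-1<..<1} x *\<^sub>R \<bar>comb_transform n x - comb_transform m x\<bar>)"
  proof (rule integral_mono_AE[OF _ _ AE])
    show "integrable lborel (\<lambda>x. s / (2*pi) * (indicator {-s..s} x *\<^sub>R ((D x)\<^sup>2 / sqrt (1 - x\<^sup>2))))"
      using hb by (intro integrable_mult_right) (auto simp: has_bochner_integral_iff)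
    show "integrable lborel (\<lambda>x. indicator {-1<..<1} x *\<^sub>R \<bar>comb_transform n x - comb_transform m x\<bar>)"
      using int by (simp add: mu_def integrable_restrict_space)
  qed
  also have "\<dots> = (LINT t|mu. \<bar>comb_transform n t - comb_transform m t\<bar>)"
    by (simp add: mu_def integral_restrict_space)
  finally show ?thesis by (simp only: dist_m_L1_comb n_def m_def)
qed

lemma comb_in_sets_mu: "comb n \<in> sets mu"
proof -
  have "{node n (2*k+2)<..<node n (2*k+1)} \<subseteq> {-1<..<1}" for k
  proof -
    have "-1 \<le> node n i" "node n i \<le> 1" for i by (auto simp: node_def)
    thus ?thesis by (meson greaterThanLessThan_iff less_le_trans le_less_trans subsetI)
  qed
  hence "comb n \<subseteq> {-1<..<1}" unfolding comb_def by blast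
  moreover have "comb n \<in> sets borel" unfolding comb_def by (intro sets.finite_UN) auto
  ultimately show ?thesis by (simp add: mu_def sets_restrict_space_iff)
qed

theorem theorem3p10: "\<not> compact (closure (m_L1 ` sets mu))"
proof
  assume "compact (closure (m_L1 ` sets mu))"
  hence sc: "seq_compact (closure (m_L1 ` sets mu))" by (rule compact_imp_seq_compact)
  define f where "f j = m_L1 (comb (2 ^ Suc j))" for j
  have "f j \<in> closure (m_L1 ` sets mu)" for j
    unfolding f_def by (intro subsetD[OF closure_subset] imageI comb_in_sets_mu)
  then obtain l r where r: "strict_mono r" "(f \<circ> r) \<longlonglongrightarrow> l"
    using sc unfolding seq_compact_def by metis
  hence "Cauchy (f \<circ> r)" by (blast intro: LIMSEQ_imp_Cauchy)
  then obtain N where N: "\<And>i j. i \<ge> N \<Longrightarrow> j \<ge> N \<Longrightarrow> dist (f (r i)) (f (r j)) < 1 / 8"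
    using metric_CauchyD[of "f \<circ> r" "1/8"] by auto
  have "r N \<noteq> r (Suc N)" using r(1) by (auto simp: strict_mono_eq)
  thus False using N[of N "Suc N"] comb_separated[of "r N" "r (Suc N)"]
    unfolding f_def by simp
qed

end
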